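(* For every real $x\ge 3$, $$K(x-1)\le\Gamma(x),$$ and equality holds for $x=3$.
   Context: $\Gamma$ is the gamma function. Kurepa's function is defined for real $x>0$ by $$K(x)=\int_0^\infty e^{-t}\,\frac{t^x-1}{t-1}\,dt .$$ *)

theory Defs
  imports "HOL-Analysis.Analysis"
begin

text \<open>
  Kurepa's function, meant for \<open>x > 0\<close>. The integrand is nonnegative on \<open>t > 0\<close>, so the
  Henstock--Kurzweil integral used here agrees with the Lebesgue and the improper Riemann integral.
  At \<open>t = 1\<close>, where the quotient has a removable singularity, the formula evaluates to 0
  by the convention on division by zero; a single point does not affect the integral.
\<close>

definition Kurepa :: "real \<Rightarrow> real" where
  "Kurepa x = integral {0..} (\<lambda>t. exp (-t) * ((t powr x - 1) / (t - 1)))"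

end

theory Submission
  imports Defs
begin

text \<open>
  Since \<open>(t powr (y + 1) - t powr y) / (t - 1) = t powr y\<close>, one has
  \<open>Kurepa (y + 1) = Kurepa y + Gamma (y + 1)\<close>. Hence \<open>Kurepa y \<le> Gamma (y + 1)\<close> propagates from
  \<open>y\<close> to \<open>y + 1\<close>, and it remains to treat \<open>y = s + 2\<close> with \<open>0 \<le> s \<le> 1\<close>, where the claim reads
  \<open>Kurepa s \<le> s * (s + 2) * Gamma (s + 1)\<close>. Substituting \<open>t = exp (2 * v)\<close> in
  \<open>sinh (s * v) \<le> s * sinh v\<close> bounds the integrand of \<open>Kurepa s\<close> by that of
  \<open>s * Gamma ((s + 1) / 2)\<close>, and log-convexity of the Gamma function finishes the comparison.
\<close>

abbreviation kurepa_integrand :: "real \<Rightarrow> real \<Rightarrow> real" where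
  "kurepa_integrand x t \<equiv> exp (-t) * ((t powr x - 1) / (t - 1))"

text \<open>The difference of the two sides vanishes at 0 and its derivative
  \<open>s * (cosh x - cosh (s * x))\<close> is nonnegative, since \<open>cosh\<close> increases on
  the nonnegative reals.\<close>

lemma sinh_mult_le:
  fixes s v :: real
  assumes "0 \<le> s" "s \<le> 1" "0 \<le> v"
  shows "sinh (s * v) \<le> s * sinh v"
proof -
  have "s * sinh 0 - sinh (s * 0) \<le> s * sinh v - sinh (s * v)"
  proof (rule DERIV_nonneg_imp_nondecreasing[OF assms(3)])
    fix x :: real assume "0 \<le> x" "x \<le> v"
    then have "cosh (s * x) \<le> cosh x"
      using assms by (simp add: cosh_real_nonneg_le_iff mult_left_le_one_le)
    then have "0 \<le> s * cosh x - cosh (s * x) * s"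
      using assms by (simp add: mult.commute mult_left_mono)
    moreover have "((\<lambda>x. s * sinh x - sinh (s * x)) has_real_derivative
        s * cosh x - cosh (s * x) * s) (at x)"
      by (auto intro!: derivative_eq_intros)
    ultimately show "\<exists>y. ((\<lambda>x. s * sinh x - sinh (s * x)) has_real_derivative y) (at x) \<and> 0 \<le> y"
      by blast
  qed
  then show ?thesis by simp
qed

lemma powr_minus_one_quotient_le:
  fixes s t :: real
  assumes s: "0 \<le> s" "s \<le> 1" and t: "0 < t" "t \<noteq> 1"
  shows "(t powr s - 1) / (t - 1) \<le> s * t powr ((s - 1) / 2)"
proof -
  define v where "v = ln t / 2"
  have v0: "v \<noteq> 0" using t by (simp add: v_def)
  have tv: "t = exp (2 * v)" using t by (simp add: v_def)
  \<comment> \<open>Used with \<open>u = s * v\<close> for the numerator and \<open>u = v\<close>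
    for the denominator.\<close>
  have factor: "exp (2 * u) - 1 = 2 * exp u * sinh u" for u :: real
    using exp_double[of u] by (simp add: sinh_def exp_minus power2_eq_square field_simps)
  have "sinh (s * v) / sinh v \<le> s"
  proof (cases "v > 0")
    case True
    then show ?thesis
      using sinh_mult_le[OF s, of v] by (simp add: divide_le_eq)
  next
    case False
    then have "v < 0" using v0 by simp
    \<comment> \<open>The ratio \<open>sinh (s * v) / sinh v\<close> is even in
      \<open>v\<close>.\<close>
    then show ?thesis
      using sinh_mult_le[OF s, of "-v"] by (simp add: divide_le_eq)
  qed
  then have "exp ((s - 1) * v) * (sinh (s * v) / sinh v) \<le> exp ((s - 1) * v) * s"
    by (intro mult_left_mono) auto
  moreover have "(t powr s - 1) / (t - 1) = exp ((s - 1) * v) * (sinh (s * v) / sinh v)"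
  proof -
    have "t powr s = exp (2 * (s * v))" by (simp add: tv powr_def)
    then have "(t powr s - 1) / (t - 1) = (2 * exp (s * v) * sinh (s * v)) / (2 * exp v * sinh v)"
      using factor[of "s * v"] factor[of v] tv by simp
    also have "\<dots> = (exp (s * v) / exp v) * (sinh (s * v) / sinh v)" by simp
    also have "exp (s * v) / exp v = exp ((s - 1) * v)"
      by (simp add: left_diff_distrib flip: exp_diff)
    finally show ?thesis .
  qed
  moreover have "t powr ((s - 1) / 2) = exp ((s - 1) * v)"
    by (simp add: tv powr_def)
  ultimately show ?thesis by (simp add: mult.commute)
qed

lemma powr_minus_one_quotient_nonneg:
  fixes s t :: real
  assumes "0 \<le> s" "0 < t"
  shows "0 \<le> (t powr s - 1) / (t - 1)"
proof (cases "t \<ge> 1")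
  case True
  then show ?thesis using assms by (simp add: ge_one_powr_ge_zero)
next
  case False
  then have "t powr s \<le> 1" using assms by (simp add: powr_le1)
  then show ?thesis using False by (simp add: divide_nonpos_nonpos)
qed

lemma Kurepa_le_base:
  assumes s: "0 \<le> s" "s \<le> 1"
  shows "kurepa_integrand s integrable_on {0..}"
    and "Kurepa s \<le> s * Gamma ((s + 1) / 2)"
proof -
  \<comment> \<open>At \<open>t = 0\<close> the convention \<open>0 powr a = 0\<close> makes the
    integrand 1 and the bound \<open>?g\<close> 0, so the comparison fails there; at
    \<open>t = 1\<close> the quotient is degenerate.\<close>
  let ?S = "{0..} - {0, 1} :: real set"
  let ?g = "\<lambda>t. s * (t powr ((s + 1) / 2 - 1) / exp t)"
  have spike: "(f has_integral I) ?S \<longleftrightarrow> (f has_integral I) {0..}" for f :: "real \<Rightarrow> real" and I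
    by (rule has_integral_spike_set_eq; rule negligible_subset[of "{0, 1}"]) auto
  have g: "(?g has_integral s * Gamma ((s + 1) / 2)) {0..}"
    using s by (intro has_integral_mult_right Gamma_integral_real) auto
  then have gS: "(?g has_integral s * Gamma ((s + 1) / 2)) ?S"
    by (simp only: spike)
  have le: "kurepa_integrand s t \<le> ?g t" if "t \<in> ?S" for t
  proof -
    have "(s + 1) / 2 - 1 = (s - 1) / 2" by (simp add: field_simps)
    then have "kurepa_integrand s t \<le> exp (-t) * (s * t powr ((s + 1) / 2 - 1))"
      using powr_minus_one_quotient_le[OF s, of t] that by (intro mult_left_mono) auto
    also have "\<dots> = ?g t" by (simp add: exp_minus field_simps)
    finally show ?thesis .
  qed
  have "kurepa_integrand s integrable_on ?S"
  proof (rule measurable_bounded_by_integrable_imp_integrable)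
    show "kurepa_integrand s \<in> borel_measurable (lebesgue_on ?S)"
      by (intro measurable_restrict_space1 measurable_completion) measurable
    show "?g integrable_on ?S" using gS by blast
    show "norm (kurepa_integrand s t) \<le> ?g t" if "t \<in> ?S" for t
    proof -
      have "0 \<le> kurepa_integrand s t"
        using that s by (intro mult_nonneg_nonneg powr_minus_one_quotient_nonneg) auto
      then have "norm (kurepa_integrand s t) = kurepa_integrand s t"
        by (simp only: real_norm_def abs_of_nonneg)
      then show ?thesis using le[OF that] by simp
    qed
    show "?S \<in> sets lebesgue" by simp
  qed
  then obtain I where I: "(kurepa_integrand s has_integral I) ?S" by blast
  then have I': "(kurepa_integrand s has_integral I) {0..}"
    by (simp only: spike)
  then show "kurepa_integrand s integrable_on {0..}" by blast
  have "I \<le> s * Gamma ((s + 1) / 2)"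
    using has_integral_le[OF I gS] le by blast
  then show "Kurepa s \<le> s * Gamma ((s + 1) / 2)"
    using I' unfolding Kurepa_def by (simp add: integral_unique)
qed

lemma has_integral_kurepa_integrand_plus_one:
  assumes "y \<ge> 0" "kurepa_integrand y integrable_on {0..}"
  shows "(kurepa_integrand (y + 1) has_integral (Kurepa y + Gamma (y + 1))) {0..}"
proof -
  have sum: "((\<lambda>t. kurepa_integrand y t + t powr (y + 1 - 1) / exp t)
      has_integral (Kurepa y + Gamma (y + 1))) {0..}"
    using assms unfolding Kurepa_def
    by (intro has_integral_add Gamma_integral_real integrable_integral) auto
  \<comment> \<open>At \<open>t = 1\<close> the division convention breaks this identity: the left
    side is 0, the right side \<open>exp (-1)\<close>.\<close>
  have eq: "kurepa_integrand (y + 1) t = kurepa_integrand y t + t powr (y + 1 - 1) / exp t"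
    if "t \<in> {0..} - {0, 1}" for t
  proof -
    have "t powr (y + 1) = t * t powr y" using that by (simp add: powr_add)
    then show ?thesis using that by (simp add: exp_minus field_simps)
  qed
  show ?thesis
    by (rule has_integral_spike[where S = "{0, 1}", OF _ eq sum]) auto
qed

text \<open>Domination by a Gamma integrand settles exponents in [0, 1]; the recurrence carries
  integrability upwards in unit steps.\<close>

lemma kurepa_integrand_integrable:
  assumes "y \<ge> 0"
  shows "kurepa_integrand y integrable_on {0..}"
proof -
  have "kurepa_integrand (s + real n) integrable_on {0..}" if "0 \<le> s" "s \<le> 1" for s n
  proof (induction n)
    case 0
    then show ?case using Kurepa_le_base(1)[OF that] by simp
  next
    case (Suc n)
    then show ?case
      using has_integral_kurepa_integrand_plus_one[of "s + real n"] that
      by (auto simp: add_ac integrable_on_def)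
  qed
  from this[of "frac y" "nat \<lfloor>y\<rfloor>"] show ?thesis
    using assms frac_lt_1[of y] by (simp add: frac_def)
qed

lemma Kurepa_plus_one: "y \<ge> 0 \<Longrightarrow> Kurepa (y + 1) = Kurepa y + Gamma (y + 1)"
  using has_integral_kurepa_integrand_plus_one[of y] kurepa_integrand_integrable[of y]
  unfolding Kurepa_def by (simp add: integral_unique)

lemma Gamma_real_plus_one: "(x::real) > 0 \<Longrightarrow> Gamma (x + 1) = x * Gamma x"
  by (rule Gamma_plus1) auto

text \<open>On [1/2, 1] the convex function \<open>ln Gamma\<close> lies below its chord, which runs
  from \<open>ln (sqrt pi)\<close> to 0; 9/5 is a rational upper bound for
  \<open>sqrt pi\<close>.\<close>

lemma Gamma_half_interval_le:
  assumes s: "0 \<le> s" "s \<le> (1::real)"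
  shows "Gamma ((s + 1) / 2) \<le> 9 / 5"
proof -
  have "ln (Gamma ((1 - s) * (1 / 2) + s * 1)) \<le> (1 - s) * ln (Gamma (1 / 2)) + s * ln (Gamma (1::real))"
    using convex_onD[OF log_convex_Gamma_real, of s "1 / 2" 1] s by simp
  also have "(1 - s) * (1 / 2) + s * 1 = (s + 1) / 2" by (simp add: field_simps)
  also have "Gamma (1 / 2 :: real) = sqrt pi" by (rule Gamma_one_half_real)
  also have "(1 - s) * ln (sqrt pi) + s * ln (Gamma 1) \<le> ln (9 / 5)"
  proof -
    have "pi \<le> (9 / 5)\<^sup>2" using pi_approx by (simp add: power2_eq_square)
    then have "sqrt pi \<le> 9 / 5" by (intro real_le_lsqrt) auto
    then have "ln (sqrt pi) \<le> ln (9 / 5)" by simp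
    then have "(1 - s) * ln (sqrt pi) \<le> (1 - s) * ln (9 / 5)"
      using s by (simp add: mult_left_mono)
    also have "\<dots> \<le> ln (9 / 5)" using s by (simp add: mult_left_le_one_le)
    finally show ?thesis by simp
  qed
  finally show ?thesis using s by (simp add: Gamma_real_pos)
qed

text \<open>By convexity the chord of \<open>ln Gamma\<close> from 2 to \<open>s + 3\<close> is at
  least as steep as the one from 2 to 3, whose slope is \<open>ln 2\<close>. The weight
  \<open>u\<close> writes 3 as a convex combination of 2 and \<open>s + 3\<close>.\<close>

lemma Gamma_real_ge_two_powr:
  assumes s: "0 \<le> (s::real)"
  shows "Gamma (s + 3) \<ge> 2 powr (s + 1)"
proof -
  have G3: "Gamma (3::real) = 2" using Gamma_fact[of 2, where 'a=real] by (simp add: numeral_eq_Suc)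
  have G2: "Gamma (2::real) = 1" using Gamma_fact[of 1, where 'a=real] by simp
  define u where "u = 1 / (s + 1)"
  have u: "0 \<le> u" "u \<le> 1" "u * (s + 1) = 1" using s by (auto simp: u_def)
  have three: "(1 - u) * 2 + u * (s + 3) = 3" using u(3) by (simp add: algebra_simps)
  have "ln (Gamma ((1 - u) * 2 + u * (s + 3))) \<le>
      (1 - u) * ln (Gamma 2) + u * ln (Gamma (s + 3))"
    using convex_onD[OF log_convex_Gamma_real, of u 2 "s + 3"] s u by simp
  then have "ln (Gamma (3::real)) \<le> (1 - u) * ln (Gamma 2) + u * ln (Gamma (s + 3))"
    by (simp only: three)
  then have "ln 2 \<le> ln (Gamma (s + 3)) / (s + 1)"
    by (simp add: G2 G3 u_def)
  then have "(s + 1) * ln 2 \<le> ln (Gamma (s + 3))"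
    using s by (simp add: field_simps)
  then have "exp ((s + 1) * ln 2) \<le> exp (ln (Gamma (s + 3)))" by simp
  then show ?thesis using s by (simp add: powr_def Gamma_real_pos)
qed

text \<open>It suffices that \<open>9 / 5 \<le> (s + 2) * Gamma (s + 1)\<close>. Multiplied by
  \<open>s + 1\<close>, this becomes a linear lower bound for \<open>Gamma (s + 3)\<close>, which
  follows from the exponential one.\<close>

lemma Kurepa_le_Gamma_base:
  assumes s: "0 \<le> s" "s \<le> 1"
  shows "Kurepa s \<le> s * (s + 2) * Gamma (s + 1)"
proof -
  have "9 / 5 * (s + 1) \<le> exp 1 * ln 2 * (s + 1)"
  proof -
    have "27 / 10 \<le> exp (1::real)"
      using e_approx_32 by (simp add: abs_if split: if_splits)
    \<comment> \<open>The product of these rational lower bounds for e and \<open>ln 2\<close> is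
      exactly 9/5.\<close>
    then have "(27 / 10) * (2 / 3) \<le> exp 1 * ln (2::real)"
      using ln2_ge_two_thirds by (intro mult_mono) simp_all
    then show ?thesis using s by (intro mult_right_mono) auto
  qed
  also have "\<dots> \<le> 2 powr (s + 1)"
  proof -
    \<comment> \<open>The tangent bound \<open>exp 1 * z \<le> exp z\<close>, taken at
      \<open>z = (s + 1) * ln 2\<close>.\<close>
    have "(s + 1) * ln 2 \<le> exp ((s + 1) * ln 2 - 1)"
      using exp_ge_add_one_self[of "(s + 1) * ln 2 - 1"] by simp
    then show ?thesis by (simp add: exp_diff powr_def field_simps)
  qed
  also have "\<dots> \<le> Gamma (s + 3)" using Gamma_real_ge_two_powr[OF s(1)] .
  also have "\<dots> = (s + 2) * (s + 1) * Gamma (s + 1)"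
    using s Gamma_real_plus_one[of "s + 2"] Gamma_real_plus_one[of "s + 1"] by (simp add: add_ac)
  finally have "9 / 5 * (s + 1) \<le> (s + 2) * Gamma (s + 1) * (s + 1)"
    by (simp only: mult_ac)
  then have "9 / 5 \<le> (s + 2) * Gamma (s + 1)"
    by (rule mult_right_le_imp_le) (use s in simp)
  then have "Gamma ((s + 1) / 2) \<le> (s + 2) * Gamma (s + 1)"
    using Gamma_half_interval_le[OF s] by linarith
  then have "s * Gamma ((s + 1) / 2) \<le> s * ((s + 2) * Gamma (s + 1))"
    using s by (intro mult_left_mono)
  then show ?thesis using Kurepa_le_base(2)[OF s] by (simp add: mult_ac)
qed

lemma Kurepa_le_Gamma_plus:
  assumes s: "0 \<le> s" "s \<le> 1"
  shows "Kurepa (s + 2 + real n) \<le> Gamma (s + 3 + real n)"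
proof (induction n)
  case 0
  have "Kurepa (s + 2) = Kurepa s + Gamma (s + 1) + Gamma (s + 2)"
    using Kurepa_plus_one[of s] Kurepa_plus_one[of "s + 1"] s by (simp add: add_ac)
  also have "\<dots> \<le> s * (s + 2) * Gamma (s + 1) + Gamma (s + 1) + Gamma (s + 2)"
    using Kurepa_le_Gamma_base[OF s] by simp
  \<comment> \<open>The coefficients of \<open>Gamma (s + 1)\<close> add up:
    \<open>s * (s + 2) + 1 + (s + 1) = (s + 1) * (s + 2)\<close>.\<close>
  also have "\<dots> = Gamma (s + 3)"
    using Gamma_real_plus_one[of "s + 1"] Gamma_real_plus_one[of "s + 2"] s
    by (simp add: add_ac algebra_simps)
  finally show ?case by simp
next
  case (Suc n)
  let ?x = "s + 3 + real n"
  have "Kurepa (s + 2 + real (Suc n)) = Kurepa (s + 2 + real n) + Gamma ?x"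
    using Kurepa_plus_one[of "s + 2 + real n"] s by (simp add: add_ac)
  also have "\<dots> \<le> 2 * Gamma ?x" using Suc by simp
  \<comment> \<open>Here \<open>?x \<ge> 3\<close> absorbs the factor 2.\<close>
  also have "\<dots> \<le> ?x * Gamma ?x"
    using s by (intro mult_right_mono) (auto simp: Gamma_real_pos less_imp_le)
  also have "\<dots> = Gamma (s + 3 + real (Suc n))"
    using Gamma_real_plus_one[of ?x] s by (simp add: add_ac)
  finally show ?case .
qed

theorem theorem4p3:
  "(\<forall>x::real. x \<ge> 3 \<longrightarrow> Kurepa (x - 1) \<le> Gamma x) \<and> Kurepa (3 - 1) = Gamma 3"
proof (intro conjI allI impI)
  fix x :: real assume "x \<ge> 3"
  then show "Kurepa (x - 1) \<le> Gamma x"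
    using Kurepa_le_Gamma_plus[of "frac x" "nat (\<lfloor>x\<rfloor> - 3)"] frac_lt_1[of x]
    by (simp add: frac_def le_floor_iff)
next
  \<comment> \<open>The integrand vanishes except at \<open>t = 0\<close>, where
    \<open>0 powr 0 = 0\<close> makes it 1. Two steps of the recurrence then give
    \<open>Gamma 1 + Gamma 2 = 2\<close>.\<close>
  have "Kurepa 0 = integral {0..} (\<lambda>t::real. 0)"
    unfolding Kurepa_def by (rule integral_spike[where S = "{0}"]) auto
  then show "Kurepa (3 - 1) = Gamma 3"
    using Kurepa_plus_one[of 0] Kurepa_plus_one[of 1] Gamma_real_plus_one[of 2]
      Gamma_real_plus_one[of 1] by simp
qed

end
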